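(* There is a subset $T\subset H^2$ of the Lobachevsky plane with $|T|=3$ such that for any partition $H^2=A_1\cup A_2$ of $H^2$ into two pieces (not necessarily Borel), either $A_1$ or $A_2$ contains an unbounded subset $S$ that is symmetric with respect to some point $c\in T$, i.e. $f_c(S)=S$.
   Context: For a point $c\in H^2$, the central symmetry $f_c:H^2\to H^2$ is the involutive isometry assigning to each $x\in H^2$ the unique point $y\in H^2$ such that $c$ is the midpoint of the hyperbolic segment $[x,y]$. A subset $S\subset H^2$ is symmetric with respect to $c$ if $f_c(S)=S$. "Unbounded" refers to the hyperbolic metric. *)

theory Defs
  imports "HOL-Analysis.Analysis"
begin

text \<open>The Lobachevsky plane \<open>H\<^sup>2\<close> in the upper half-plane model, as a metric space under the
  hyperbolic distance of curvature \<open>-1\<close>.\<close>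

typedef hyp_plane = "{z :: complex. 0 < Im z}"
  morphisms uhp_coord Abs_hyp_plane
  by (rule exI[of _ "\<i>"]) simp

lemma Im_uhp_coord_pos [simp]: "0 < Im (uhp_coord p)"
  using uhp_coord[of p] by simp

instantiation hyp_plane :: metric_space
begin

text \<open>Equivalently \<open>cosh (dist p q) = 1 + \<bar>z - w\<bar>\<^sup>2 / (2 Im z Im w)\<close> for the coordinates \<open>z\<close>, \<open>w\<close>
  of \<open>p\<close>, \<open>q\<close>; see \<open>cosh_dist_hyp_plane\<close>.\<close>

definition dist_hyp_plane :: "hyp_plane \<Rightarrow> hyp_plane \<Rightarrow> real" where
  "dist p q = 2 * arsinh (cmod (uhp_coord p - uhp_coord q)
                            / (2 * sqrt (Im (uhp_coord p) * Im (uhp_coord q))))"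

definition uniformity_hyp_plane :: "(hyp_plane \<times> hyp_plane) filter" where
  "uniformity_hyp_plane = (INF e\<in>{0<..}. principal {(x, y). dist x y < e})"

definition open_hyp_plane :: "hyp_plane set \<Rightarrow> bool" where
  "open_hyp_plane U = (\<forall>x\<in>U. \<forall>\<^sub>F (x', y) in uniformity. x' = x \<longrightarrow> y \<in> U)"

lemma sinh_half_dist:
  "sinh (dist p q / 2) = cmod (uhp_coord p - uhp_coord q)
                            / (2 * sqrt (Im (uhp_coord p) * Im (uhp_coord q)))"
  by (simp add: dist_hyp_plane_def)

lemma cosh_half_dist:
  "cosh (dist p q / 2) = cmod (uhp_coord p - cnj (uhp_coord q))
                            / (2 * sqrt (Im (uhp_coord p) * Im (uhp_coord q)))"
proof (rule power2_eq_imp_eq)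
  let ?z = "uhp_coord p" and ?w = "uhp_coord q"
  have pos: "0 < Im ?z" "0 < Im ?w" "0 \<le> Im ?z * Im ?w" "Im ?z \<noteq> 0" "Im ?w \<noteq> 0"
    by (simp_all add: less_imp_le less_imp_neq[symmetric])
  have "(cosh (dist p q / 2))\<^sup>2 = (cmod (?z - ?w))\<^sup>2 / (4 * (Im ?z * Im ?w)) + 1"
    using pos unfolding cosh_square_eq sinh_half_dist
    by (simp add: power_divide power_mult_distrib)
  also have "\<dots> = ((cmod (?z - ?w))\<^sup>2 + 4 * (Im ?z * Im ?w)) / (4 * (Im ?z * Im ?w))"
    using pos by (simp add: field_simps)
  also have "(cmod (?z - ?w))\<^sup>2 + 4 * (Im ?z * Im ?w) = (cmod (?z - cnj ?w))\<^sup>2"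
    by (simp add: cmod_power2) algebra
  also have "\<dots> / (4 * (Im ?z * Im ?w)) = (cmod (?z - cnj ?w) / (2 * sqrt (Im ?z * Im ?w)))\<^sup>2"
    using pos by (simp add: power_divide power_mult_distrib)
  finally show "(cosh (dist p q / 2))\<^sup>2 = (cmod (?z - cnj ?w) / (2 * sqrt (Im ?z * Im ?w)))\<^sup>2" .
qed (simp_all add: less_imp_le)

instance
proof
  fix x y z :: hyp_plane
  show "(dist x y = 0) = (x = y)"
  proof
    assume "dist x y = 0"
    then have "sinh (dist x y / 2) = 0" by simp
    then have "uhp_coord x = uhp_coord y"
      unfolding sinh_half_dist
      by (auto simp: less_imp_neq[symmetric] dest: arg_cong[where f = "\<lambda>t. 0 < t"])
    then show "x = y" by (simp add: uhp_coord_inject)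
  qed (simp add: dist_hyp_plane_def)
  show "dist x y \<le> dist x z + dist y z"
  proof -
    let ?x = "uhp_coord x" and ?y = "uhp_coord y" and ?z = "uhp_coord z"
    define a b c where "a = sqrt (Im ?x)" and "b = sqrt (Im ?y)" and "c = sqrt (Im ?z)"
    have pos: "0 < a" "0 < b" "0 < c" by (simp_all add: a_def b_def c_def)
    have c2: "c * c = Im ?z" by (simp add: c_def less_imp_le)
    have "(?x - ?y) * (?z - cnj ?z) = (?x - ?z) * (?y - cnj ?z) - (?x - cnj ?z) * (?y - ?z)"
      by (simp add: algebra_simps)
    then have "cmod (?x - ?y) * cmod (?z - cnj ?z)
        \<le> cmod (?x - ?z) * cmod (?y - cnj ?z) + cmod (?x - cnj ?z) * cmod (?y - ?z)"
      by (metis norm_mult norm_triangle_ineq4)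
    moreover have "cmod (?z - cnj ?z) = 2 * (c * c)"
      by (simp add: complex_diff_cnj norm_mult c2 less_imp_le)
    ultimately have "cmod (?x - ?y) * (2 * (c * c))
        \<le> cmod (?x - ?z) * cmod (?y - cnj ?z) + cmod (?x - cnj ?z) * cmod (?y - ?z)"
      by simp
    then have "cmod (?x - ?y) / (2 * (a * b))
        \<le> cmod (?x - ?z) / (2 * (a * c)) * (cmod (?y - cnj ?z) / (2 * (b * c)))
          + cmod (?x - cnj ?z) / (2 * (a * c)) * (cmod (?y - ?z) / (2 * (b * c)))"
      using pos by (simp add: field_simps)
    then have "sinh (dist x y / 2) \<le> sinh (dist x z / 2 + dist y z / 2)"
      unfolding sinh_add sinh_half_dist cosh_half_dist
      by (simp add: real_sqrt_mult a_def b_def c_def)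
    then show ?thesis by simp
  qed
qed (simp_all only: uniformity_hyp_plane_def open_hyp_plane_def)

end

lemma cosh_dist_hyp_plane:
  fixes p q :: hyp_plane
  shows "cosh (dist p q) = 1 + (cmod (uhp_coord p - uhp_coord q))\<^sup>2
                                 / (2 * Im (uhp_coord p) * Im (uhp_coord q))"
proof -
  have pos: "0 \<le> Im (uhp_coord p) * Im (uhp_coord q)" by (simp add: less_imp_le)
  have "cosh (dist p q) = 2 * (sinh (dist p q / 2))\<^sup>2 + 1"
    using cosh_double_cosh[of "dist p q / 2"] by (simp add: cosh_square_eq)
  also have "\<dots> = 1 + (cmod (uhp_coord p - uhp_coord q))\<^sup>2
                                 / (2 * Im (uhp_coord p) * Im (uhp_coord q))"
    using pos unfolding sinh_half_dist by (simp add: power_divide power_mult_distrib)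
  finally show ?thesis .
qed

text \<open>Hyperbolic segments are described metrically: \<open>z\<close> lies on the geodesic segment \<open>[x, y]\<close> iff
  the triangle inequality through \<open>z\<close> is an equality.\<close>

definition hyp_segment :: "hyp_plane \<Rightarrow> hyp_plane \<Rightarrow> hyp_plane set" where
  "hyp_segment x y = {z. dist x z + dist z y = dist x y}"

definition hyp_midpoint :: "hyp_plane \<Rightarrow> hyp_plane \<Rightarrow> hyp_plane \<Rightarrow> bool" where
  "hyp_midpoint c x y \<longleftrightarrow> c \<in> hyp_segment x y \<and> dist x c = dist c y"

text \<open>The description is proper by \<open>hyp_midpoint_ex1\<close>.\<close>

definition central_symmetry :: "hyp_plane \<Rightarrow> hyp_plane \<Rightarrow> hyp_plane" where
  "central_symmetry c x = (THE y. hyp_midpoint c x y)"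

definition symmetric_wrt :: "hyp_plane \<Rightarrow> hyp_plane set \<Rightarrow> bool" where
  "symmetric_wrt c S \<longleftrightarrow> central_symmetry c ` S = S"

text \<open>The half-turn about \<open>a + b\<i>\<close> is \<open>z \<mapsto> a - b\<^sup>2 / (z - a)\<close>.\<close>

definition half_turn :: "hyp_plane \<Rightarrow> hyp_plane \<Rightarrow> hyp_plane" where
  "half_turn c x = (let a = Re (uhp_coord c); b = Im (uhp_coord c) in
     Abs_hyp_plane (of_real a - of_real (b\<^sup>2) / (uhp_coord x - of_real a)))"

lemma uhp_coord_half_turn:
  "uhp_coord (half_turn c x) = of_real (Re (uhp_coord c))
     - of_real ((Im (uhp_coord c))\<^sup>2) / (uhp_coord x - of_real (Re (uhp_coord c)))"
proof -
  have "0 < (Re (uhp_coord x) - Re (uhp_coord c))\<^sup>2 + (Im (uhp_coord x))\<^sup>2"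
    by (simp add: add_nonneg_pos less_imp_neq[symmetric])
  then show ?thesis
    by (simp add: half_turn_def Let_def Abs_hyp_plane_inverse Im_divide zero_less_mult_iff
        less_imp_neq[symmetric])
qed

text \<open>In the hyperboloid model this is the linear relation \<open>x + f\<^sub>c x = 2 cosh (dist x c) c\<close>,
  paired with \<open>y\<close>.\<close>

lemma cosh_dist_half_turn:
  "cosh (dist (half_turn c x) y) + cosh (dist x y) = 2 * cosh (dist x c) * cosh (dist c y)"
proof -
  obtain a b where c: "uhp_coord c = Complex a b" by (cases "uhp_coord c")
  obtain u v where x: "uhp_coord x = Complex u v" by (cases "uhp_coord x")
  obtain s t where y: "uhp_coord y = Complex s t" by (cases "uhp_coord y")
  have pos: "0 < b" "0 < v" "0 < t"
    using Im_uhp_coord_pos[of c] Im_uhp_coord_pos[of x] Im_uhp_coord_pos[of y]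
    by (simp_all add: c x y)
  define N where "N = (u - a)\<^sup>2 + v\<^sup>2"
  have N: "0 < N" using pos by (simp add: N_def add_nonneg_pos)
  have h: "uhp_coord (half_turn c x) = Complex (a - b\<^sup>2 * (u - a) / N) (b\<^sup>2 * v / N)"
    unfolding uhp_coord_half_turn c x
    by (simp add: complex_eq_iff Re_divide Im_divide N_def)
  have A: "(a - b\<^sup>2 * (u - a) / N - s)\<^sup>2 + (b\<^sup>2 * v / N - t)\<^sup>2
      = ((a - s)\<^sup>2 + t\<^sup>2) + (b\<^sup>2 * b\<^sup>2 - 2 * b\<^sup>2 * ((u - a) * (a - s) + v * t)) / N"
  proof -
    have "(b\<^sup>2 * (u - a) / N)\<^sup>2 + (b\<^sup>2 * v / N)\<^sup>2 = b\<^sup>2 * b\<^sup>2 * ((u - a)\<^sup>2 + v\<^sup>2) / (N * N)"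
      by (simp add: power_divide power_mult_distrib add_divide_distrib distrib_left
          flip: power2_eq_square power_mult)
    also have "\<dots> = b\<^sup>2 * b\<^sup>2 / N" using N by (simp add: N_def[symmetric])
    finally have PQ: "(b\<^sup>2 * (u - a) / N)\<^sup>2 + (b\<^sup>2 * v / N)\<^sup>2 = b\<^sup>2 * b\<^sup>2 / N" .
    have "(a - P - s)\<^sup>2 + (Q - t)\<^sup>2 = ((a - s)\<^sup>2 + t\<^sup>2) + (P\<^sup>2 + Q\<^sup>2) - 2 * (P * (a - s) + Q * t)"
      for P Q by algebra
    then show ?thesis
      using PQ by (simp add: add_divide_distrib diff_divide_distrib distrib_left mult.assoc)
  qed
  have B: "cosh (dist (half_turn c x) y)
      = 1 + (N * ((a - s)\<^sup>2 + t\<^sup>2) + (b\<^sup>2 * b\<^sup>2 - 2 * b\<^sup>2 * ((u - a) * (a - s) + v * t)))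
            / (2 * b\<^sup>2 * v * t)"
    unfolding cosh_dist_hyp_plane h y cmod_power2 complex.sel minus_complex.sel A
    using N pos by (simp add: field_simps)
  show ?thesis
    unfolding B unfolding cosh_dist_hyp_plane c x y cmod_power2
    using pos by (simp add: N_def field_simps) algebra
qed

lemma dist_half_turn_center: "dist c (half_turn c x) = dist x c"
proof -
  have "cosh (dist (half_turn c x) c) = cosh (dist x c)"
    using cosh_dist_half_turn[of c x c] by simp
  then show ?thesis by (simp add: dist_commute)
qed

lemma hyp_midpoint_iff: "hyp_midpoint c x y \<longleftrightarrow> y = half_turn c x"
proof
  assume "hyp_midpoint c x y"
  then have "dist c y = dist x c" "dist x y = 2 * dist x c"
    by (auto simp: hyp_midpoint_def hyp_segment_def)
  then have "cosh (dist (half_turn c x) y) = 1"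
    using cosh_dist_half_turn[of c x y] by (simp add: cosh_double_cosh power2_eq_square)
  then show "y = half_turn c x" by simp
next
  assume y: "y = half_turn c x"
  have "cosh (dist x y) = cosh (2 * dist x c)"
    using cosh_dist_half_turn[of c x y]
    by (simp add: y cosh_double_cosh dist_half_turn_center power2_eq_square)
  then show "hyp_midpoint c x y"
    by (simp add: hyp_midpoint_def hyp_segment_def y dist_half_turn_center)
qed

lemma hyp_midpoint_ex1: "\<exists>!y. hyp_midpoint c x y"
  by (simp add: hyp_midpoint_iff)

lemma central_symmetry_eq_half_turn: "central_symmetry c x = half_turn c x"
  by (simp add: central_symmetry_def hyp_midpoint_iff)

lemma central_symmetry_involutive: "central_symmetry c (central_symmetry c x) = x"
proof -
  have "hyp_midpoint c x (half_turn c x)" by (simp add: hyp_midpoint_iff)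
  then have "hyp_midpoint c (half_turn c x) x"
    by (simp add: hyp_midpoint_def hyp_segment_def dist_commute add.commute)
  then show ?thesis by (simp add: hyp_midpoint_iff central_symmetry_eq_half_turn)
qed

lemma dist_central_symmetry: "dist (central_symmetry c x) (central_symmetry c y) = dist x y"
proof -
  have "cosh (dist (half_turn c x) (half_turn c y)) = cosh (dist x y)"
    using cosh_dist_half_turn[of c x "half_turn c y"] cosh_dist_half_turn[of c y x]
    by (simp add: dist_half_turn_center dist_commute algebra_simps del: cosh_real_eq_iff)
  then show ?thesis by (simp add: central_symmetry_eq_half_turn)
qed

end

theory Submission
  imports Defs
begin

text \<open>If neither piece contains an unbounded symmetric set, then every \<open>f\<^sub>c\<close> with \<open>c \<in> T\<close>
  exchanges the two pieces outside a bounded set, so a word of odd length in these symmetries also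
  exchanges them outside a bounded set and cannot be the identity. The product of the half-turns
  about the midpoints of the sides of a triangle is a rotation about a vertex by the angle sum of
  the triangle. In the hyperbolic plane this sum can be \<open>2\<pi>/3\<close>, and then the word
  \<open>(f\<^sub>a f\<^sub>b f\<^sub>c)\<^sup>3\<close> of length \<open>9\<close> is the identity.\<close>

lemma unbounded_hyp_plane: "\<not> bounded (UNIV :: hyp_plane set)"
proof
  assume "bounded (UNIV :: hyp_plane set)"
  define p where "p t = Abs_hyp_plane (Complex 0 t)" for t
  have p: "uhp_coord (p t) = Complex 0 t" if "0 < t" for t
    using that by (simp add: p_def Abs_hyp_plane_inverse)
  obtain B where B: "dist (p 1) y \<le> B" for y
    using \<open>bounded UNIV\<close> bounded_any_center[of UNIV "p 1"] by auto
  have B0: "0 \<le> B" using B[of "p 1"] by simp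
  \<comment> \<open>On the imaginary axis the \<open>cosh\<close> of the distance from
    \<open>p 1\<close> to \<open>p t\<close> is (t + 1/t)/2, which exceeds t/2 and hence
    \<open>cosh B\<close>.\<close>
  define t where "t = 2 * cosh B + 1"
  have t: "1 < t" using cosh_real_pos[of B] by (simp add: t_def)
  have "cosh (dist (p 1) (p t)) \<le> cosh B"
    using B B0 by (simp add: cosh_real_nonneg_le_iff)
  moreover have "cosh (dist (p 1) (p t)) = 1 + (1 - t)\<^sup>2 / (2 * t)"
    using t by (simp add: cosh_dist_hyp_plane p cmod_power2)
  moreover have "t / 2 < 1 + (1 - t)\<^sup>2 / (2 * t)"
    using t by (simp add: field_simps power2_eq_square)
  ultimately show False using t_def by linarith
qed

lemma bounded_vimage_central_symmetry:
  assumes "bounded X"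
  shows "bounded (central_symmetry c -` X)"
proof -
  obtain p B where "\<forall>x\<in>X. dist p x \<le> B"
    using assms by (auto simp: bounded_def)
  then have "\<forall>x\<in>central_symmetry c -` X. dist (central_symmetry c p) x \<le> B"
    by (metis central_symmetry_involutive dist_central_symmetry vimageE)
  then show ?thesis by (auto simp: bounded_def)
qed

text \<open>The set splits into the points staying in \<open>A\<close> and those staying in
  \<open>- A\<close>. Each part is symmetric because the symmetry is an involution.\<close>

lemma bounded_colour_preserved:
  assumes "\<And>S. S \<subseteq> A \<or> S \<subseteq> - A \<Longrightarrow> symmetric_wrt c S \<Longrightarrow> bounded S"
  shows "bounded {x. central_symmetry c x \<in> A \<longleftrightarrow> x \<in> A}"
proof -
  have sym: "symmetric_wrt c (X \<inter> central_symmetry c -` X)" for X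
  proof -
    have "x \<in> central_symmetry c ` (X \<inter> central_symmetry c -` X)"
      if "x \<in> X" "central_symmetry c x \<in> X" for x
      using that central_symmetry_involutive[of c x]
      by (intro image_eqI[where x = "central_symmetry c x"]) auto
    then show ?thesis
      by (auto simp: symmetric_wrt_def central_symmetry_involutive)
  qed
  have "{x. central_symmetry c x \<in> A \<longleftrightarrow> x \<in> A}
      = (A \<inter> central_symmetry c -` A) \<union> (- A \<inter> central_symmetry c -` (- A))"
    by auto
  then show ?thesis using assms[OF _ sym] by auto
qed

text \<open>As \<open>fold\<close> applies the head first, a violation for \<open>c # cs\<close> at
  x means that \<open>c\<close> keeps the piece of x or that \<open>cs\<close> has a violation at
  the image of x under \<open>c\<close>.\<close>

lemma bounded_parity_violation:
  assumes "\<And>c. c \<in> set cs \<Longrightarrow> bounded {x. central_symmetry c x \<in> A \<longleftrightarrow> x \<in> A}"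
  shows "bounded {x. (fold central_symmetry cs x \<in> A \<longleftrightarrow> x \<in> A) \<noteq> even (length cs)}"
  using assms
proof (induction cs)
  case (Cons c cs)
  let ?V = "{x. (fold central_symmetry cs x \<in> A \<longleftrightarrow> x \<in> A) \<noteq> even (length cs)}"
  have "bounded (central_symmetry c -` ?V)"
    using Cons by (intro bounded_vimage_central_symmetry) simp
  with Cons.prems[of c]
  have "bounded ({x. central_symmetry c x \<in> A \<longleftrightarrow> x \<in> A} \<union> central_symmetry c -` ?V)"
    by simp
  then show ?case by (rule bounded_subset) auto
qed simp

lemma odd_relation_imp_unbounded_symmetric:
  assumes "odd (length cs)" and id: "\<And>x. fold central_symmetry cs x = x"
  shows "\<exists>S. (S \<subseteq> A \<or> S \<subseteq> - A) \<and> \<not> bounded S \<and> (\<exists>c\<in>set cs. symmetric_wrt c S)"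
proof (rule ccontr)
  assume "\<not> ?thesis"
  then have "bounded {x. (fold central_symmetry cs x \<in> A \<longleftrightarrow> x \<in> A) \<noteq> even (length cs)}"
    by (intro bounded_parity_violation bounded_colour_preserved) auto
  \<comment> \<open>The identity never changes the piece, so with odd length every point is a
    violation.\<close>
  then show False using assms unbounded_hyp_plane by simp
qed

text \<open>In \<open>PSL\<^sub>2(\<real>)\<close> the product of the three half-turns below is given by the matrix with rows
  \<open>(2, -13)\<close> and \<open>(4, -8)\<close>. Its squared trace equals its determinant, so it has order \<open>3\<close>.\<close>

lemma exists_half_turns_order_3:
  "\<exists>a b c. distinct [a, b, c] \<and>
    (\<forall>x. fold central_symmetry [c, b, a, c, b, a, c, b, a] x = x)"
proof -
  define a where "a = Abs_hyp_plane (Complex 0 1)"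
  define b where "b = Abs_hyp_plane (Complex 0 2)"
  \<comment> \<open>For a third centre p + qi, the product with the half-turns about i and 2i has
    trace 3p up to sign and determinant 4q^2. The order 3 condition 9p^2 = 4q^2 holds for 2 +
    3i.\<close>
  define c where "c = Abs_hyp_plane (Complex 2 3)"
  have coord: "uhp_coord a = Complex 0 1" "uhp_coord b = Complex 0 2" "uhp_coord c = Complex 2 3"
    by (simp_all add: a_def b_def c_def Abs_hyp_plane_inverse)
  define g where "g x = half_turn a (half_turn b (half_turn c x))" for x
  have nonreal: "uhp_coord x \<noteq> of_real r" for x r
    using Im_uhp_coord_pos[of x] by (metis Im_complex_of_real less_irrefl)
  have g: "uhp_coord (g x) = (2 * uhp_coord x - 13) / (4 * uhp_coord x - 8)" for x
  proof -
    have "uhp_coord x - 2 \<noteq> 0" using nonreal[of x 2] by simp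
    then show ?thesis
      by (simp add: g_def uhp_coord_half_turn coord field_simps)
  qed
  have "g (g (g x)) = x" for x
  proof -
    define z where "z = uhp_coord x"
    have z: "4 * z - 8 \<noteq> 0" "4 * z - 2 \<noteq> 0"
      using nonreal[of x 2] nonreal[of x "1/2"] by (auto simp: z_def field_simps)
    have num: "2 * uhp_coord (g x) - 13 = (78 - 48 * z) / (4 * z - 8)"
      and den: "4 * uhp_coord (g x) - 8 = (12 - 24 * z) / (4 * z - 8)"
      using z(1) by (simp_all add: g z_def field_simps)
    have "uhp_coord (g (g x)) = (78 - 48 * z) / (12 - 24 * z)"
      unfolding g[of "g x"] num den using z(1) by simp
    \<comment> \<open>By Cayley-Hamilton the square of the matrix M is -6(M + 6), and M + 6
      represents the inverse of \<open>g\<close>.\<close>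
    also have "\<dots> = (- 6 * (8 * z - 13)) / (- 6 * (4 * z - 2))"
      by (simp add: right_diff_distrib)
    finally have gg: "uhp_coord (g (g x)) = (8 * z - 13) / (4 * z - 2)"
      by (subst (asm) mult_divide_mult_cancel_left) simp_all
    have num': "2 * uhp_coord (g (g x)) - 13 = - 36 * z / (4 * z - 2)"
      and den': "4 * uhp_coord (g (g x)) - 8 = - 36 / (4 * z - 2)"
      using z(2) by (simp_all add: gg field_simps)
    have "uhp_coord (g (g (g x))) = uhp_coord x"
      unfolding g[of "g (g x)"] num' den' using z(2) by (simp add: z_def)
    then show ?thesis by (simp add: uhp_coord_inject)
  qed
  then have "fold central_symmetry [c, b, a, c, b, a, c, b, a] x = x" for x
    by (simp add: central_symmetry_eq_half_turn g_def)
  moreover have "distinct [a, b, c]"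
    using coord by auto
  ultimately show ?thesis by blast
qed

theorem theorem2:
  shows "\<exists>T :: hyp_plane set. card T = 3 \<and>
    (\<forall>A1 A2 :: hyp_plane set. A1 \<union> A2 = UNIV \<and> A1 \<inter> A2 = {} \<longrightarrow>
      (\<exists>S. (S \<subseteq> A1 \<or> S \<subseteq> A2) \<and> \<not> bounded S \<and> (\<exists>c\<in>T. symmetric_wrt c S)))"
proof -
  obtain a b c where d: "distinct [a, b, c]"
    and id: "fold central_symmetry [c, b, a, c, b, a, c, b, a] x = x" for x
    using exists_half_turns_order_3 by blast
  have main: "\<exists>S. (S \<subseteq> A \<or> S \<subseteq> - A) \<and> \<not> bounded S \<and> (\<exists>p\<in>{a, b, c}. symmetric_wrt p S)" for A
    using odd_relation_imp_unbounded_symmetric[OF _ id, of A] by auto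
  show ?thesis
  proof (rule exI[of _ "{a, b, c}"], intro conjI allI impI)
    show "card {a, b, c} = 3" using d by simp
    fix A1 A2 :: "hyp_plane set"
    assume "A1 \<union> A2 = UNIV \<and> A1 \<inter> A2 = {}"
    then have "A2 = - A1" by auto
    with main[of A1]
    show "\<exists>S. (S \<subseteq> A1 \<or> S \<subseteq> A2) \<and> \<not> bounded S \<and> (\<exists>p\<in>{a, b, c}. symmetric_wrt p S)"
      by simp
  qed
qed

end
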